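(* Let $\Phi=(G,\mathbb{T},\phi)$ be a complex unit gain graph and let $\mu(G)$ be the matching number of its underlying graph $G$. Then $$\mathcal{E}(\Phi)\ge 2\mu(G).$$ Moreover, equality holds if and only if $\Phi$ is balanced and $G$ is the disjoint union of some regular complete bipartite graphs (i.e. graphs $K_{m,m}$ with $m\ge 1$), together with some isolated vertices.
   Context: All graphs are finite, undirected and simple. Let $\mathbb{T}=\{z\in\mathbb{C}: |z|=1\}$. For a graph $G$, let $\vec{E}(G)=\{e_{uv},e_{vu} : uv\in E(G)\}$, where $e_{uv}$ denotes the ordered pair $(u,v)$. A complex unit gain graph $\Phi=(G,\mathbb{T},\phi)$ consists of a graph $G$ (its underlying graph) and a map $\phi:\vec{E}(G)\to\mathbb{T}$ with $\phi(e_{uv})=\phi(e_{vu})^{-1}$. For a cycle $v_1v_2\cdots v_kv_1$ of $G$, its gain is $\phi(e_{v_1v_2})\phi(e_{v_2v_3})\cdots\phi(e_{v_kv_1})$; the cycle is neutral if this gain equals $1$ (this does not depend on the direction). $\Phi$ is balanced if every cycle of $G$ is neutral. The adjacency matrix of $\Phi$ on vertices $v_1,\dots,v_n$ is the Hermitian matrix $A(\Phi)=(a_{ij})$ with $a_{ij}=\phi(e_{v_iv_j})$ if $v_iv_j\in E(G)$ and $a_{ij}=0$ otherwise. The energy $\mathcal{E}(\Phi)$ is the sum of the absolute values of the eigenvalues of $A(\Phi)$. The matching number $\mu(G)$ is the maximum size of a set of pairwise vertex-disjoint edges of $G$. *)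

theory Defs
  imports
    "Graph_Theory.Kuratowski"
    "Jordan_Normal_Form.Spectral_Radius"
    "HOL-Library.Disjoint_Sets"
begin

text \<open>
  A simple graph is a \<open>pair_graph\<close>: a finite, loop-free, symmetric relation \<open>parcs G\<close> on the
  vertex set \<open>pverts G\<close>. Both orientations of an edge are arcs, so the gain function is defined
  on \<open>parcs G\<close>; its values elsewhere are irrelevant.
\<close>

locale unit_gain_graph = pair_graph G
  for G :: "'v pair_pre_digraph" +
  fixes \<phi> :: "'v \<times> 'v \<Rightarrow> complex"
  assumes gain_unit: "(u, v) \<in> parcs G \<Longrightarrow> cmod (\<phi> (u, v)) = 1"
    and gain_inverse: "(u, v) \<in> parcs G \<Longrightarrow> \<phi> (u, v) = inverse (\<phi> (v, u))"

definition walk_gain :: "('v \<times> 'v \<Rightarrow> complex) \<Rightarrow> ('v \<times> 'v) awalk \<Rightarrow> complex" where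
  "walk_gain \<phi> p = prod_list (map \<phi> p)"

text \<open>
  In a symmetric digraph \<open>pre_digraph.cycle\<close> also holds of \<open>[(u, v), (v, u)]\<close>, which is not a cycle
  of the undirected graph; hence the bound on the length.
\<close>

definition graph_cycle :: "'v pair_pre_digraph \<Rightarrow> ('v \<times> 'v) awalk \<Rightarrow> bool" where
  "graph_cycle G p \<longleftrightarrow> pre_digraph.cycle (with_proj G) p \<and> 3 \<le> length p"

definition balanced :: "'v pair_pre_digraph \<Rightarrow> ('v \<times> 'v \<Rightarrow> complex) \<Rightarrow> bool" where
  "balanced G \<phi> \<longleftrightarrow> (\<forall>p. graph_cycle G p \<longrightarrow> walk_gain \<phi> p = 1)"

text \<open>The list \<open>vs\<close> is the chosen ordering of the vertices.\<close>

definition adjacency_matrix ::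
    "'v pair_pre_digraph \<Rightarrow> ('v \<times> 'v \<Rightarrow> complex) \<Rightarrow> 'v list \<Rightarrow> complex mat" where
  "adjacency_matrix G \<phi> vs = mat (length vs) (length vs)
     (\<lambda>(i, j). if (vs ! i, vs ! j) \<in> parcs G then \<phi> (vs ! i, vs ! j) else 0)"

text \<open>Eigenvalues are counted with (algebraic) multiplicity.\<close>

definition energy ::
    "'v pair_pre_digraph \<Rightarrow> ('v \<times> 'v \<Rightarrow> complex) \<Rightarrow> 'v list \<Rightarrow> real" where
  "energy G \<phi> vs = (let A = adjacency_matrix G \<phi> vs in
     \<Sum>z\<in>spectrum A. real (Polynomial.order z (char_poly A)) * cmod z)"

definition edge_set :: "'v pair_pre_digraph \<Rightarrow> 'v set set" where
  "edge_set G = {{u, v} | u v. (u, v) \<in> parcs G}"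

definition matching :: "'v pair_pre_digraph \<Rightarrow> 'v set set \<Rightarrow> bool" where
  "matching G M \<longleftrightarrow> M \<subseteq> edge_set G \<and> disjoint M"

definition matching_number :: "'v pair_pre_digraph \<Rightarrow> nat" where
  "matching_number G = Max (card ` {M. matching G M})"

text \<open>
  \<open>\<H>\<close> is the (possibly empty) set of components \<open>K\<^bsub>m,m\<^esub>\<close>, where \<open>m\<close> may vary,
  and \<open>I\<close> is the (possibly empty) set of isolated vertices.
\<close>

definition union_of_regular_complete_bipartite :: "'v pair_pre_digraph \<Rightarrow> bool" where
  "union_of_regular_complete_bipartite G \<longleftrightarrow>
     (\<exists>(\<H> :: 'v pair_pre_digraph set) (I :: 'v set).
        (\<forall>H\<in>\<H>. \<exists>m\<ge>1. complete_bipartite_digraph m m (with_proj H)) \<and>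
        pairwise (\<lambda>H H'. disjnt (pverts H) (pverts H')) \<H> \<and>
        (\<forall>H\<in>\<H>. disjnt (pverts H) I) \<and>
        pverts G = (\<Union>H\<in>\<H>. pverts H) \<union> I \<and>
        parcs G = (\<Union>H\<in>\<H>. parcs H))"

end

theory Submission
  imports Defs
begin

text \<open>
  Let \<open>A\<close> have real eigenvalues \<open>l k\<close> with orthonormal eigenvectors \<open>x k\<close>, let \<open>M\<close> be a maximum
  matching, and let \<open>W\<close> be the part of \<open>A\<close> supported on the edges of \<open>M\<close>. Then
  \<open>tr (W A) = 2 card M\<close>, and since \<open>W\<close> is a contraction, \<open>tr (W A)\<close> is at most the trace norm of
  \<open>A\<close>, which is the energy. The difference is a sum of squares weighted by \<open>\<bar>l k\<bar>\<close>, and it vanishes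
  iff \<open>W (x k) = sgn (l k) x k\<close> whenever \<open>l k \<noteq> 0\<close>, i.e. \<open>W A = \<bar>A\<bar>\<close>. In that case uncovered vertices
  are isolated, and \<open>W A\<close> is positive semidefinite with unit diagonal on the covered vertices and
  entries of modulus 0 or 1. So it is the Gram matrix of unit vectors that are pairwise parallel or
  orthogonal. In terms of \<open>A\<close>: every walk \<open>a b c d\<close> is closed up by an edge \<open>a d\<close> whose gain is the
  gain of the walk. For a graph whose maximum matching covers all non-isolated vertices, this
  condition is equivalent both to equality and to being a balanced union of graphs \<open>K\<^bsub>m,m\<^esub>\<close>.
\<close>

section \<open>Unitary diagonalization of Hermitian matrices\<close>

lemma dim_mat_adjoint [simp]:
  "dim_row (mat_adjoint A) = dim_col A" "dim_col (mat_adjoint A) = dim_row A"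
  by (simp_all add: mat_adjoint_def)

lemma index_mat_adjoint [simp]:
  assumes "i < dim_col A" and "j < dim_row A"
  shows "mat_adjoint A $$ (i, j) = conjugate (A $$ (j, i))"
  using assms by (simp add: mat_adjoint_def mat_of_rows_def)

lemma mat_adjoint_carrier [simp]:
  "A \<in> carrier_mat nr nc \<Longrightarrow> mat_adjoint A \<in> carrier_mat nc nr"
  by (intro carrier_matI) auto

lemma mat_adjoint_mat_adjoint [simp]: "mat_adjoint (mat_adjoint A) = A"
  by (rule eq_matI) simp_all

lemma mat_adjoint_mult:
  fixes A B :: "complex mat"
  assumes "A \<in> carrier_mat l m" and "B \<in> carrier_mat m n"
  shows "mat_adjoint (A * B) = mat_adjoint B * mat_adjoint A"
  using assms
  by (intro eq_matI) (auto simp: scalar_prod_def mult.commute)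

text \<open>\<open>corthogonal\<close> only makes the columns nonzero and pairwise orthogonal, so
  each is divided by its norm. The scalar is real, hence fixed by conjugation.\<close>

lemma unitary_mat_of_orthogonal_cols:
  fixes ws :: "complex vec list"
  assumes ws: "set ws \<subseteq> carrier_vec n" and len: "length ws = n" and orth: "corthogonal ws"
  defines "W \<equiv> mat_of_cols n (map (\<lambda>w. complex_of_real (1 / sqrt (Re (w \<bullet>c w))) \<cdot>\<^sub>v w) ws)"
  shows "mat_adjoint W * W = 1\<^sub>m n"
proof (rule eq_matI)
  have W: "W \<in> carrier_mat n n"
    using mat_of_cols_carrier(1)[of n] len unfolding W_def by auto
  fix i j assume "i < dim_row (1\<^sub>m n :: complex mat)" "j < dim_col (1\<^sub>m n :: complex mat)"
  then have ij: "i < n" "j < n" by auto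
  define c where "c = (\<lambda>w :: complex vec. complex_of_real (1 / sqrt (Re (w \<bullet>c w))))"
  have wi: "ws ! i \<in> carrier_vec n" and wj: "ws ! j \<in> carrier_vec n"
    using ws len ij by auto
  have ent: "W $$ (r, k) = c (ws ! k) * ws ! k $ r" if "r < n" "k < n" for r k
  proof -
    have "ws ! k \<in> carrier_vec n" using that ws len by auto
    then show ?thesis using that len unfolding W_def c_def by (simp add: mat_of_cols_index)
  qed
  have "(mat_adjoint W * W) $$ (i, j) = (\<Sum>r<n. cnj (W $$ (r, i)) * W $$ (r, j))"
    using W ij by (auto simp: scalar_prod_def lessThan_atLeast0)
  also have "\<dots> = (\<Sum>r<n. c (ws ! i) * c (ws ! j) * (ws ! j $ r * cnj (ws ! i $ r)))"
    using ij by (intro sum.cong) (auto simp: ent c_def)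
  also have "\<dots> = c (ws ! i) * c (ws ! j) * (ws ! j \<bullet>c ws ! i)"
    using wi wj by (auto simp: scalar_prod_def lessThan_atLeast0 sum_distrib_left)
  also have "\<dots> = 1\<^sub>m n $$ (i, j)"
  proof (cases "i = j")
    case True
    define z where "z = ws ! i \<bullet>c ws ! i"
    have "z \<noteq> 0"
      using corthogonalD[OF orth, of i i] ij len by (simp add: z_def)
    moreover have "z \<ge> 0"
      by (simp add: z_def conjugate_square_ge_0_vec)
    ultimately have "z = complex_of_real (Re z)" "Re z > 0"
      by (auto simp: less_eq_complex_def complex_eq_iff order_less_le)
    then obtain r where r: "z = complex_of_real r" "r > 0" by blast
    have "1 / sqrt r * (1 / sqrt r) * r = 1" using r(2) by simp
    then have "c (ws ! i) * c (ws ! i) * z = 1"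
      unfolding c_def z_def[symmetric] r(1) Re_complex_of_real of_real_mult[symmetric] by simp
    then show ?thesis using True ij by (simp add: z_def)
  next
    case False
    then show ?thesis using corthogonalD[OF orth, of j i] ij len by auto
  qed
  finally show "(mat_adjoint W * W) $$ (i, j) = 1\<^sub>m n $$ (i, j)" .
qed (use len in \<open>auto simp: W_def\<close>)

text \<open>Rewrite rules for conjugations of square matrices of one size: products associate to the
  right and adjoints move inward.\<close>

lemma square_mat_mult:
  fixes A B C :: "complex mat"
  assumes "A \<in> carrier_mat n n" and "B \<in> carrier_mat n n"
  shows "A * B \<in> carrier_mat n n"
    and "C \<in> carrier_mat n n \<Longrightarrow> A * B * C = A * (B * C)"
    and "mat_adjoint (A * B) = mat_adjoint B * mat_adjoint A"
  using assms by (auto intro: mat_adjoint_mult)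

text \<open>Deflation along the list of roots. An eigenvector for the first root is completed to a
  unitary \<open>W\<close>; conjugation by \<open>W\<close> clears the first column, hence by
  hermiticity the first row, and the remaining block has the remaining roots.\<close>

theorem hermitian_unitary_diagonalization:
  fixes A :: "complex mat"
  assumes "A \<in> carrier_mat n n" and "mat_adjoint A = A"
    and "char_poly A = (\<Prod>e\<leftarrow>es. [:- e, 1:])"
  shows "\<exists>U \<in> carrier_mat n n. mat_adjoint U * U = 1\<^sub>m n \<and>
    mat_adjoint U * A * U = mat n n (\<lambda>(i, j). if i = j then es ! i else 0)"
  using assms
proof (induction es arbitrary: n A)
  case Nil
  then have "n = 0" using degree_monic_char_poly[of A n] by auto
  then show ?case by (intro bexI[of _ "1\<^sub>m 0"]) (auto intro!: eq_matI)
next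
  case (Cons e es n A)
  note A = Cons.prems(1)
  have n: "n \<noteq> 0"
  proof
    assume "n = 0"
    then have "degree (char_poly A) = 0" using degree_monic_char_poly[OF A] by simp
    then show False using degree_linear_factors[of uminus "e # es"] Cons.prems(3) by simp
  qed
  then obtain n1 where n1: "n = Suc n1" by (cases n) auto
  have "eigenvalue A e"
    unfolding eigenvalue_root_char_poly[OF A] Cons.prems(3) by simp
  then obtain v where v: "v \<in> carrier_vec n" "v \<noteq> 0\<^sub>v n" "A *\<^sub>v v = e \<cdot>\<^sub>v v"
    using A unfolding eigenvalue_def eigenvector_def by auto
  interpret cof_vec_space n "TYPE(complex)" .
  define ws where "ws = gram_schmidt n (basis_completion v)"
  note bc = basis_completion[OF v(1,2)]
  have ws: "set ws \<subseteq> carrier_vec n" "corthogonal ws" "length ws = n"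
    using gram_schmidt_result[OF bc(2,4,5) ws_def] bc(6) by auto
  obtain vs where "basis_completion v = v # vs"
    using bc(6,7) n by (cases "basis_completion v") auto
  \<comment> \<open>Gram-Schmidt keeps the first vector, so the first column of \<open>W\<close> is
    a multiple of the eigenvector \<open>v\<close>.\<close>
  then have hdws: "ws ! 0 = v"
    using gram_schmidt_hd[OF v(1), of vs] ws(3) n unfolding ws_def
    by (metis hd_conv_nth length_0_conv)
  define c where "c = complex_of_real (1 / sqrt (Re (v \<bullet>c v)))"
  define W where "W = mat_of_cols n (map (\<lambda>w. complex_of_real (1 / sqrt (Re (w \<bullet>c w))) \<cdot>\<^sub>v w) ws)"
  have W: "W \<in> carrier_mat n n"
    using mat_of_cols_carrier(1)[of n] ws(3) unfolding W_def by auto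
  have WW: "mat_adjoint W * W = 1\<^sub>m n"
    unfolding W_def by (rule unitary_mat_of_orthogonal_cols[OF ws(1,3,2)])
  have W': "mat_adjoint W \<in> carrier_mat n n" using W by simp
  have WW': "W * mat_adjoint W = 1\<^sub>m n"
    by (rule mat_mult_left_right_inverse[OF W' W WW])
  have colW: "col W 0 = c \<cdot>\<^sub>v v"
    using n ws hdws v(1) unfolding W_def c_def by (subst col_mat_of_cols) auto
  define B where "B = mat_adjoint W * A * W"
  have B: "B \<in> carrier_mat n n" unfolding B_def using A W W' by (intro mult_carrier_mat)
  have herm: "mat_adjoint B = B"
    using A W W' Cons.prems(2)
    by (simp add: B_def square_mat_mult[of _ n])
  have cW: "col W 0 \<in> carrier_vec n" using W n by auto
  have "col B 0 = (mat_adjoint W * A) *\<^sub>v col W 0"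
    unfolding B_def by (rule col_mult2[of _ n n _ n]) (use A W W' n in auto)
  also have "\<dots> = mat_adjoint W *\<^sub>v (A *\<^sub>v col W 0)"
    by (rule assoc_mult_mat_vec[OF W' A cW])
  also have "A *\<^sub>v col W 0 = e \<cdot>\<^sub>v col W 0"
    unfolding colW mult_mat_vec[OF A v(1)] v(3) smult_smult_assoc by (simp add: mult.commute)
  also have "mat_adjoint W *\<^sub>v (e \<cdot>\<^sub>v col W 0) = e \<cdot>\<^sub>v col (mat_adjoint W * W) 0"
    using n by (simp only: mult_mat_vec[OF W' cW] col_mult2[OF W' W])
  finally have colB: "col B 0 = e \<cdot>\<^sub>v unit_vec n 0"
    using n by (simp add: WW)
  have B0: "B $$ (i, 0) = (if i = 0 then e else 0)" if "i < n" for i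
    using arg_cong[OF colB, of "\<lambda>w. w $ i"] that B n by auto
  have B0': "B $$ (0, i) = (if i = 0 then e else 0)" if "i < n" for i
  proof -
    have "B $$ (0, i) = cnj (B $$ (i, 0))"
      using arg_cong[OF herm, of "\<lambda>M. M $$ (0, i)"] B n that by auto
    then show ?thesis using B0 that n by auto
  qed
  define A3 where "A3 = mat n1 n1 (\<lambda>(i, j). B $$ (Suc i, Suc j))"
  have A3: "A3 \<in> carrier_mat n1 n1" by (simp add: A3_def)
  have block: "B = four_block_mat (mat 1 1 (\<lambda>_. e)) (0\<^sub>m 1 n1) (0\<^sub>m n1 1) A3"
    using B B0 B0' n1 by (intro eq_matI) (auto simp: A3_def)
  have herm3: "mat_adjoint A3 = A3"
  proof (rule eq_matI)
    fix i j assume "i < dim_row A3" "j < dim_col A3"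
    then show "mat_adjoint A3 $$ (i, j) = A3 $$ (i, j)"
      using arg_cong[OF herm, of "\<lambda>M. M $$ (Suc i, Suc j)"] B n1 by (auto simp: A3_def)
  qed (use A3 in auto)
  \<comment> \<open>Similarity preserves the characteristic polynomial, so cancelling the factor of
    \<open>e\<close> leaves that of \<open>A3\<close>.\<close>
  have "similar_mat_wit A B W (mat_adjoint W)"
  proof (rule similar_mat_witI[OF WW' WW _ A B W W'])
    have "W * B * mat_adjoint W = (W * mat_adjoint W) * (A * (W * mat_adjoint W))"
      using A W W' unfolding B_def by (simp add: square_mat_mult[of _ n])
    then show "A = W * B * mat_adjoint W" using A by (simp add: WW')
  qed
  then have "char_poly A = char_poly B"
    by (intro char_poly_similar) (auto simp: similar_mat_def)
  also have "\<dots> = char_poly (mat 1 1 (\<lambda>_. e)) * char_poly A3"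
    unfolding block by (rule char_poly_four_block_zeros_col) (auto simp: A3)
  also have "char_poly (mat 1 1 (\<lambda>_. e)) = [:- e, 1:]"
    by (simp add: char_poly_defs det_def sign_def)
  finally have "char_poly A3 = (\<Prod>e\<leftarrow>es. [:- e, 1:])"
    using Cons.prems(3) by (metis (no_types, lifting) list.simps(9) mult_cancel_left pCons_eq_0_iff prod_list.Cons zero_neq_one)
  from Cons.IH[OF A3 herm3 this] obtain U where U: "U \<in> carrier_mat n1 n1"
    "mat_adjoint U * U = 1\<^sub>m n1"
    "mat_adjoint U * A3 * U = mat n1 n1 (\<lambda>(i, j). if i = j then es ! i else 0)"
    by blast
  \<comment> \<open>\<open>Z\<close> applies the smaller diagonalizing matrix to all coordinates but
    the first; \<open>W * Z\<close> is the required unitary.\<close>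
  define Z where "Z = four_block_mat (1\<^sub>m 1) (0\<^sub>m 1 n1) (0\<^sub>m n1 1) U"
  have Z: "Z \<in> carrier_mat n n" using U(1) n1 unfolding Z_def
    by (metis four_block_carrier_mat one_carrier_mat plus_1_eq_Suc)
  have adjZ: "mat_adjoint Z = four_block_mat (1\<^sub>m 1) (0\<^sub>m 1 n1) (0\<^sub>m n1 1) (mat_adjoint U)"
    using U(1) unfolding Z_def by (intro eq_matI) auto
  have U': "mat_adjoint U \<in> carrier_mat n1 n1" using U(1) by simp
  have ZZ: "mat_adjoint Z * Z = 1\<^sub>m n"
    unfolding adjZ unfolding Z_def
    using U U' n1
    by (subst mult_four_block_mat[of _ 1 1 _ n1 _ n1 _ _ 1 _ n1]) (auto intro!: eq_matI)
  have ZBZ: "mat_adjoint Z * B * Z = mat n n (\<lambda>(i, j). if i = j then (e # es) ! i else 0)"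
  proof -
    have UA: "mat_adjoint U * A3 \<in> carrier_mat n1 n1" using U' A3 by simp
    have U0: "mat_adjoint U * 0\<^sub>m n1 (Suc 0) = 0\<^sub>m n1 (Suc 0)"
      "mat_adjoint U * A3 * 0\<^sub>m n1 (Suc 0) = 0\<^sub>m n1 (Suc 0)"
      by (rule right_mult_zero_mat[OF U'], rule right_mult_zero_mat[OF UA])
    have "mat_adjoint Z * B = four_block_mat (mat 1 1 (\<lambda>_. e)) (0\<^sub>m 1 n1) (0\<^sub>m n1 1) (mat_adjoint U * A3)"
      unfolding adjZ block using A3 U' UA
      by (subst mult_four_block_mat[of _ 1 1 _ n1 _ n1 _ _ 1 _ n1]) (auto simp: U0)
    then have "mat_adjoint Z * B * Z
      = four_block_mat (mat 1 1 (\<lambda>_. e)) (0\<^sub>m 1 n1) (0\<^sub>m n1 1) (mat_adjoint U * A3 * U)"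
      unfolding Z_def using UA U(1)
      by (simp, subst mult_four_block_mat[of _ 1 1 _ n1 _ n1 _ _ 1 _ n1]) (auto simp: U0)
    then show ?thesis unfolding U(3) using n1
      by (intro eq_matI) (auto simp: nth_Cons')
  qed
  have Z': "mat_adjoint Z \<in> carrier_mat n n" using Z by simp
  have "mat_adjoint (W * Z) * (W * Z) = mat_adjoint Z * (mat_adjoint W * W) * Z"
    using W W' Z Z' by (simp add: square_mat_mult[of _ n])
  then have 1: "mat_adjoint (W * Z) * (W * Z) = 1\<^sub>m n"
    unfolding WW right_mult_one_mat[OF Z'] ZZ .
  have "mat_adjoint (W * Z) * A * (W * Z) = mat_adjoint Z * B * Z"
    using A W W' Z Z' unfolding B_def
    by (simp add: square_mat_mult[of _ n])
  then show ?case using 1 ZBZ W Z by (intro bexI[of _ "W * Z"]) auto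
qed

section \<open>Energy and eigenbases of gain graphs\<close>

lemma order_prod_linear_factors:
  fixes es :: "'a::idom list"
  shows "Polynomial.order z (\<Prod>e\<leftarrow>es. [:- e, 1:]) = count_list es z"
proof (induction es)
  case (Cons e es)
  have nz: "[:- e, 1:] * (\<Prod>e\<leftarrow>es. [:- e, 1:]) \<noteq> 0"
    unfolding mult_eq_0_iff prod_list_zero_iff by auto
  have "Polynomial.order z [:- e, 1:] = (if z = e then 1 else 0)"
    using order_power_n_n[of e 1] by (auto intro: order_0I)
  then show ?case by (simp add: order_mult[OF nz] Cons.IH del: mult_pCons_left)
qed (simp add: order_0I)

text \<open>\<open>energy\<close> sums over distinct eigenvalues with algebraic multiplicity; the
  list of roots repeats an eigenvalue exactly that often.\<close>

lemma sum_spectrum_eq_sum_list: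
  fixes A :: "complex mat" and f :: "complex \<Rightarrow> real"
  assumes "A \<in> carrier_mat n n" and "char_poly A = (\<Prod>e\<leftarrow>es. [:- e, 1:])"
  shows "(\<Sum>z\<in>spectrum A. real (Polynomial.order z (char_poly A)) * f z) = (\<Sum>e\<leftarrow>es. f e)"
proof -
  have "spectrum A = set es"
    unfolding spectrum_root_char_poly[OF assms(1)] assms(2)
    by (auto simp: poly_prod_list prod_list_zero_iff)
  \<comment> \<open>\<open>S\<close> is any finite superset of the roots, so that it stays fixed
    while the induction shortens the list.\<close>
  moreover have "(\<Sum>z\<in>S. real (count_list es z) * f z) = (\<Sum>e\<leftarrow>es. f e)"
    if "finite S" "set es \<subseteq> S" for S
    using that(2)
  proof (induction es)
    case (Cons e es)
    have "(\<Sum>z\<in>S. real (count_list (e # es) z) * f z)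
      = (\<Sum>z\<in>S. real (count_list es z) * f z + (if z = e then f z else 0))"
      by (intro sum.cong) (auto simp: algebra_simps)
    then show ?case using Cons that(1) by (simp add: sum.distrib)
  qed simp
  ultimately show ?thesis
    by (simp add: assms(2) order_prod_linear_factors)
qed

section \<open>Adjacency entries indexed by vertices\<close>

context unit_gain_graph
begin

text \<open>Indexing by vertices instead of list positions frees everything after the spectral
  theorem from the chosen ordering.\<close>

definition entry :: "'v \<Rightarrow> 'v \<Rightarrow> complex" where
  "entry u v = (if (u, v) \<in> parcs G then \<phi> (u, v) else 0)"

lemma entry_mult_entry:
  assumes "(u, v) \<in> parcs G"
  shows "entry u v * entry v u = 1"
proof -
  have "\<phi> (v, u) \<noteq> 0" using gain_unit[OF arcs_symmetric[OF assms]] by auto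
  then show ?thesis
    using assms gain_inverse[OF assms] arcs_symmetric[OF assms] by (simp add: entry_def)
qed

text \<open>On the unit circle conjugation is inversion, so \<open>gain_inverse\<close> makes the
  adjacency matrix Hermitian.\<close>

lemma cnj_entry: "cnj (entry u v) = entry v u"
proof (cases "(u, v) \<in> parcs G")
  case True
  then have "\<phi> (u, v) * cnj (\<phi> (u, v)) = 1"
    using gain_unit by (simp add: complex_norm_square[symmetric])
  then have "cnj (\<phi> (u, v)) = inverse (\<phi> (u, v))"
    by (metis inverse_unique)
  then show ?thesis
    using True arcs_symmetric[OF True] gain_inverse[OF arcs_symmetric[OF True]]
    by (simp add: entry_def)
next
  case False
  then show ?thesis using arcs_symmetric by (auto simp: entry_def)
qed

lemma entry_eq_0_iff [simp]: "entry u v = 0 \<longleftrightarrow> (u, v) \<notin> parcs G"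
  using gain_unit[of u v] by (auto simp: entry_def)

lemma cmod_entry: "(u, v) \<in> parcs G \<Longrightarrow> cmod (entry u v) = 1"
  by (simp add: entry_def gain_unit)

end

text \<open>The spectral theorem as scalar identities on vertex functions. \<open>complete\<close>
  is the resolution of the identity: the matrix with columns \<open>x k\<close> has orthonormal
  rows.\<close>

locale gain_eigenbasis = unit_gain_graph G \<phi>
  for G :: "'v pair_pre_digraph" and \<phi> +
  fixes n :: nat and l :: "nat \<Rightarrow> real" and x :: "nat \<Rightarrow> 'v \<Rightarrow> complex"
  assumes eigen: "\<lbrakk>k < n; u \<in> pverts G\<rbrakk> \<Longrightarrow>
      (\<Sum>v\<in>pverts G. entry u v * x k v) = of_real (l k) * x k u"
    and normed: "k < n \<Longrightarrow> (\<Sum>v\<in>pverts G. (cmod (x k v))\<^sup>2) = 1"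
    and complete: "\<lbrakk>u \<in> pverts G; v \<in> pverts G\<rbrakk> \<Longrightarrow>
      (\<Sum>k<n. x k u * cnj (x k v)) = (if u = v then 1 else 0)"

lemma (in unit_gain_graph) obtain_gain_eigenbasis:
  assumes "distinct vs" and vs: "set vs = pverts G"
  obtains l x where "gain_eigenbasis G \<phi> (length vs) l x"
    and "energy G \<phi> vs = (\<Sum>k<length vs. \<bar>l k\<bar>)"
proof -
  define n where "n = length vs"
  define A where "A = adjacency_matrix G \<phi> vs"
  have A: "A \<in> carrier_mat n n" by (simp add: A_def adjacency_matrix_def n_def)
  have ent: "A $$ (i, j) = entry (vs ! i) (vs ! j)" if "i < n" "j < n" for i j
    using that by (simp add: A_def adjacency_matrix_def n_def entry_def)
  have herm: "mat_adjoint A = A"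
    using A by (intro eq_matI) (auto simp: ent cnj_entry)
  obtain es where es: "char_poly A = (\<Prod>e\<leftarrow>es. [:- e, 1:])" "length es = n"
    using char_poly_factorized[OF A] by blast
  obtain U where U: "U \<in> carrier_mat n n" and UU: "mat_adjoint U * U = 1\<^sub>m n"
    and D: "mat_adjoint U * A * U = mat n n (\<lambda>(i, j). if i = j then es ! i else 0)"
    using hermitian_unitary_diagonalization[OF A herm es(1)] by blast
  define D where "D = mat n n (\<lambda>(i, j). if i = j then es ! i else 0)"
  have Dc: "D \<in> carrier_mat n n" by (simp add: D_def)
  have U': "mat_adjoint U \<in> carrier_mat n n" using U by simp
  have UU': "U * mat_adjoint U = 1\<^sub>m n"
    by (rule mat_mult_left_right_inverse[OF U' U UU])
  \<comment> \<open>In the form \<open>A * U = U * D\<close> the diagonalization says that the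
    columns of \<open>U\<close> are eigenvectors.\<close>
  have "U * D = (U * mat_adjoint U) * (A * U)"
    using A U U' D unfolding D_def[symmetric] by (simp add: square_mat_mult[of _ n])
  then have AU: "A * U = U * D"
    using A U by (simp add: UU' square_mat_mult[of _ n])
  \<comment> \<open>A unitary conjugate of a Hermitian matrix is Hermitian, so its diagonal entries
    are real.\<close>
  have "mat_adjoint D = D"
    unfolding D[folded D_def, symmetric] using A U U' herm by (simp add: square_mat_mult[of _ n])
  then have "cnj (es ! k) = es ! k" if "k < n" for k
    using that index_mat_adjoint[of k D k] by (simp add: D_def)
  then have real: "es ! k = of_real (Re (es ! k))" if "k < n" for k
    using that by (metis complex_is_Real_iff Reals_cnj_iff of_real_Re)
  \<comment> \<open>\<open>ix\<close> recovers the position of a vertex in \<open>vs\<close>; it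
    turns the columns of \<open>U\<close> into vertex functions.\<close>
  define ix where "ix = the_inv_into {..<n} ((!) vs)"
  have bij: "bij_betw ((!) vs) {..<n} (pverts G)"
    using bij_betw_nth[OF assms(1)] vs n_def by auto
  then have ix: "ix (vs ! i) = i" if "i < n" for i
    using that by (auto simp: ix_def bij_betw_def the_inv_into_f_f)
  have V: "\<exists>i<n. u = vs ! i" if "u \<in> pverts G" for u
    using that bij by (auto simp: bij_betw_def)
  define x where "x = (\<lambda>k v. U $$ (ix v, k))"
  define l where "l = (\<lambda>k. Re (es ! k))"
  have "gain_eigenbasis G \<phi> n l x"
  proof
    fix k u assume k: "k < n" and "u \<in> pverts G"
    then obtain i where i: "i < n" "u = vs ! i" using V by blast
    have "(\<Sum>v\<in>pverts G. entry u v * x k v) = (\<Sum>j<n. A $$ (i, j) * U $$ (j, k))"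
      unfolding sum.reindex_bij_betw[OF bij, symmetric] x_def
      using i by (intro sum.cong) (auto simp: ix ent)
    also have "\<dots> = (A * U) $$ (i, k)"
      using A U i k by (auto simp: scalar_prod_def lessThan_atLeast0)
    also have "\<dots> = (\<Sum>j<n. U $$ (i, j) * (if j = k then es ! k else 0))"
      unfolding AU using Dc U i k
      by (auto simp: scalar_prod_def lessThan_atLeast0 D_def intro!: sum.cong)
    also have "\<dots> = of_real (l k) * x k u"
      using k i by (simp add: if_distrib[of "\<lambda>z. _ * z"] ix x_def l_def real[symmetric] mult.commute cong: if_cong)
    finally show "(\<Sum>v\<in>pverts G. entry u v * x k v) = of_real (l k) * x k u" .
  next
    fix k assume k: "k < n"
    have "complex_of_real (\<Sum>v\<in>pverts G. (cmod (x k v))\<^sup>2) = (\<Sum>j<n. cnj (U $$ (j, k)) * U $$ (j, k))"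
      unfolding sum.reindex_bij_betw[OF bij, symmetric] x_def of_real_sum
      by (intro sum.cong) (auto simp: ix complex_norm_square mult.commute simp del: of_real_power)
    also have "\<dots> = (mat_adjoint U * U) $$ (k, k)"
      using U k by (auto simp: scalar_prod_def lessThan_atLeast0)
    also have "\<dots> = 1" using k by (simp add: UU)
    finally show "(\<Sum>v\<in>pverts G. (cmod (x k v))\<^sup>2) = 1" by (simp only: of_real_eq_1_iff)
  next
    fix u v assume "u \<in> pverts G" "v \<in> pverts G"
    then obtain i j where ij: "i < n" "u = vs ! i" "j < n" "v = vs ! j" using V by metis
    have "(\<Sum>k<n. x k u * cnj (x k v)) = (U * mat_adjoint U) $$ (i, j)"
      using U ij by (auto simp: scalar_prod_def lessThan_atLeast0 x_def ix)
    also have "\<dots> = (if u = v then 1 else 0)"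
      using ij by (auto simp: UU' n_def nth_eq_iff_index_eq[OF assms(1)])
    finally show "(\<Sum>k<n. x k u * cnj (x k v)) = (if u = v then 1 else 0)" .
  qed
  moreover have "energy G \<phi> vs = (\<Sum>k<n. \<bar>l k\<bar>)"
  proof -
    have "energy G \<phi> vs = (\<Sum>e\<leftarrow>es. cmod e)"
      unfolding energy_def Let_def A_def[symmetric] by (rule sum_spectrum_eq_sum_list[OF A es(1)])
    also have "\<dots> = (\<Sum>k<n. cmod (es ! k))"
      by (simp add: sum_list_sum_nth es(2) lessThan_atLeast0)
    also have "\<dots> = (\<Sum>k<n. \<bar>l k\<bar>)"
      using real by (intro sum.cong refl) (metis l_def lessThan_iff norm_of_real real_norm_def)
    finally show ?thesis .
  qed
  ultimately show thesis using that unfolding n_def by blast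
qed

section \<open>The lower bound\<close>

locale gain_matching = unit_gain_graph G \<phi>
  for G :: "'v pair_pre_digraph" and \<phi> +
  fixes M :: "'v set set"
  assumes matching: "matching G M"
begin

text \<open>Meaningful on covered vertices only, where disjointness of \<open>M\<close> makes the
  description unique.\<close>

definition partner :: "'v \<Rightarrow> 'v" where
  "partner u = (THE v. {u, v} \<in> M)"

lemma partner_eqI:
  assumes "{u, v} \<in> M"
  shows "partner u = v"
  unfolding partner_def
proof (rule the_equality)
  show "{u, v} \<in> M" by (rule assms)
next
  fix w assume w: "{u, w} \<in> M"
  have "disjoint M" using matching by (simp add: matching_def)
  then have "\<not> disjnt {u, w} {u, v} \<Longrightarrow> {u, w} = {u, v}"
    using w assms by (meson pairwiseD)
  then have "{u, w} = {u, v}" by (simp add: disjnt_def)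
  then show "w = v" by (auto simp: doubleton_eq_iff)
qed

lemma partner:
  assumes "u \<in> \<Union>M"
  shows "{u, partner u} \<in> M" and "(u, partner u) \<in> parcs G"
    and "partner u \<in> \<Union>M" and "partner (partner u) = u"
proof -
  obtain e where e: "e \<in> M" "u \<in> e" using assms by blast
  then obtain a b where ab: "e = {a, b}" "(a, b) \<in> parcs G"
    using matching by (auto simp: matching_def edge_set_def)
  then obtain v where v: "{u, v} \<in> M" "(u, v) \<in> parcs G"
    using e arcs_symmetric[OF ab(2)] by (auto simp: insert_commute)
  moreover have "partner u = v" by (rule partner_eqI[OF v(1)])
  moreover have "partner v = u" using v(1) by (intro partner_eqI) (simp add: insert_commute)
  ultimately show "{u, partner u} \<in> M" "(u, partner u) \<in> parcs G"
    "partner u \<in> \<Union>M" "partner (partner u) = u"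
    by auto
qed

lemma covered_subset: "\<Union>M \<subseteq> pverts G"
  using partner(2) in_arcsD1 by blast

text \<open>By symmetry every head of an arc is also a tail, so the condition on tails says that
  \<open>M\<close> covers all non-isolated vertices.\<close>

lemma covered_arcsD:
  assumes "fst ` parcs G \<subseteq> \<Union>M" and "(u, v) \<in> parcs G"
  shows "u \<in> \<Union>M" and "v \<in> \<Union>M"
  using assms(1) imageI[OF assms(2), of fst] imageI[OF arcs_symmetric[OF assms(2)], of fst]
  unfolding fst_conv by blast+

lemma finite_covered [simp]: "finite (\<Union>M)"
  using covered_subset finite_verts finite_subset by blast

lemma bij_betw_partner: "bij_betw partner (\<Union>M) (\<Union>M)"
  by (rule bij_betwI[of _ _ _ partner]) (auto intro: partner)

lemma card_covered: "card (\<Union>M) = 2 * card M"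
proof -
  have 2: "card e = 2" if "e \<in> M" for e
    using that matching no_loops' by (fastforce simp: matching_def edge_set_def card_insert_if)
  then have "card (\<Union>M) = (\<Sum>e\<in>M. card e)"
    using matching by (intro card_Union_disjoint) (auto simp: matching_def intro: card_ge_0_finite)
  then show ?thesis using 2 by simp
qed

end

section \<open>Comparison of an eigenbasis with a matching\<close>

locale gain_eigenbasis_matching =
  gain_eigenbasis G \<phi> n l x + gain_matching G \<phi> M
  for G :: "'v pair_pre_digraph" and \<phi> n l x M

lemma cmod_diff_sq: "(cmod (a - b))\<^sup>2 = (cmod a)\<^sup>2 + (cmod b)\<^sup>2 - 2 * Re (a * cnj b)"
  unfolding cmod_power2 by (simp add: power2_eq_square algebra_simps)

text \<open>Insert the resolution of the identity and let \<open>A\<close> act on each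
  \<open>x k\<close>: the spectral decomposition, entry by entry.\<close>

lemma (in gain_eigenbasis) entry_expansion:
  assumes "u \<in> pverts G" and "v \<in> pverts G"
  shows "entry u v = (\<Sum>k<n. of_real (l k) * x k u * cnj (x k v))"
proof -
  have "entry u v = (\<Sum>w\<in>pverts G. entry u w * (\<Sum>k<n. x k w * cnj (x k v)))"
    using assms(2) finite_verts by (simp add: complete if_distrib cong: if_cong)
  also have "\<dots> = (\<Sum>k<n. (\<Sum>w\<in>pverts G. entry u w * x k w) * cnj (x k v))"
    by (simp add: sum_distrib_left sum_distrib_right sum.swap[of _ "pverts G"] mult.assoc)
  also have "\<dots> = (\<Sum>k<n. of_real (l k) * x k u * cnj (x k v))"
    using assms(1) by (simp add: eigen)
  finally show ?thesis .
qed

context gain_eigenbasis_matching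
begin

text \<open>For \<open>l k \<noteq> 0\<close> this is the squared norm of
  \<open>W (x k) - sgn (l k) x k\<close> plus the squared norm that \<open>x k\<close> loses under
  \<open>W\<close>. Both include the uncovered vertices, where \<open>W\<close> vanishes; hence the
  factor 2.\<close>

definition deficit :: "nat \<Rightarrow> real" where
  "deficit k = (\<Sum>u\<in>\<Union>M. (cmod (entry u (partner u) * x k (partner u) - of_real (sgn (l k)) * x k u))\<^sup>2)
     + 2 * (\<Sum>u\<in>pverts G - \<Union>M. (cmod (x k u))\<^sup>2)"

lemma deficit_nonneg: "deficit k \<ge> 0"
  unfolding deficit_def by (intro add_nonneg_nonneg mult_nonneg_nonneg sum_nonneg) auto

lemma deficit_eq_0_iff:
  "deficit k = 0 \<longleftrightarrow>
    (\<forall>u\<in>\<Union>M. entry u (partner u) * x k (partner u) = of_real (sgn (l k)) * x k u) \<and>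
    (\<forall>u\<in>pverts G - \<Union>M. x k u = 0)"
  unfolding deficit_def using finite_verts
  by (subst add_nonneg_eq_0_iff) (auto simp: sum_nonneg sum_nonneg_eq_0_iff)

text \<open>Expand the squares. Since \<open>partner\<close> permutes the covered vertices, the two
  square terms have equal sums, and \<open>normed\<close> combines them with the uncovered part to
  the constant 2.\<close>

lemma abs_times_deficit:
  assumes "k < n"
  shows "\<bar>l k\<bar> * deficit k =
    2 * \<bar>l k\<bar> - 2 * Re (\<Sum>u\<in>\<Union>M. entry u (partner u) * (of_real (l k) * x k (partner u) * cnj (x k u)))"
proof -
  define s where "s = sgn (l k)"
  \<comment> \<open>The weight makes both identities hold for \<open>l k = 0\<close> too, where
    \<open>s = 0\<close>.\<close>
  have ls: "\<bar>l k\<bar> * (s)\<^sup>2 = \<bar>l k\<bar>" "\<bar>l k\<bar> * s = l k"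
    by (auto simp: s_def sgn_if)
  have "\<bar>l k\<bar> * (cmod (entry u (partner u) * x k (partner u) - of_real s * x k u))\<^sup>2 =
      \<bar>l k\<bar> * (cmod (x k (partner u)))\<^sup>2 + \<bar>l k\<bar> * (cmod (x k u))\<^sup>2
      - 2 * Re (entry u (partner u) * (of_real (l k) * x k (partner u) * cnj (x k u)))"
    if "u \<in> \<Union>M" for u
  proof -
    let ?e = "entry u (partner u)"
    have "(cmod (?e * x k (partner u) - of_real s * x k u))\<^sup>2
      = (cmod (x k (partner u)))\<^sup>2 + s\<^sup>2 * (cmod (x k u))\<^sup>2
        - 2 * s * Re (?e * (x k (partner u) * cnj (x k u)))"
      using cmod_entry[OF partner(2)[OF that]]
      by (simp add: cmod_diff_sq norm_mult power_mult_distrib algebra_simps)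
    then have "\<bar>l k\<bar> * (cmod (?e * x k (partner u) - of_real s * x k u))\<^sup>2
      = \<bar>l k\<bar> * (cmod (x k (partner u)))\<^sup>2 + (\<bar>l k\<bar> * s\<^sup>2) * (cmod (x k u))\<^sup>2
        - 2 * (\<bar>l k\<bar> * s) * Re (?e * (x k (partner u) * cnj (x k u)))"
      by (simp only: ring_distribs ac_simps)
    then show ?thesis unfolding ls by (simp add: algebra_simps)
  qed
  then have 1: "\<bar>l k\<bar> * (\<Sum>u\<in>\<Union>M. (cmod (entry u (partner u) * x k (partner u) - of_real s * x k u))\<^sup>2)
    = \<bar>l k\<bar> * (\<Sum>u\<in>\<Union>M. (cmod (x k (partner u)))\<^sup>2) + \<bar>l k\<bar> * (\<Sum>u\<in>\<Union>M. (cmod (x k u))\<^sup>2)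
      - 2 * Re (\<Sum>u\<in>\<Union>M. entry u (partner u) * (of_real (l k) * x k (partner u) * cnj (x k u)))"
    by (simp add: sum_distrib_left sum.distrib sum_subtractf)
  have 2: "(\<Sum>u\<in>\<Union>M. (cmod (x k (partner u)))\<^sup>2) = (\<Sum>u\<in>\<Union>M. (cmod (x k u))\<^sup>2)"
    by (rule sum.reindex_bij_betw[OF bij_betw_partner])
  have 3: "(\<Sum>u\<in>pverts G - \<Union>M. (cmod (x k u))\<^sup>2) = 1 - (\<Sum>u\<in>\<Union>M. (cmod (x k u))\<^sup>2)"
    using normed[OF assms] sum.subset_diff[OF covered_subset finite_verts, of "\<lambda>u. (cmod (x k u))\<^sup>2"]
    by simp
  show ?thesis unfolding deficit_def s_def[symmetric] distrib_left 1 2 3 by (simp add: algebra_simps)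
qed

text \<open>Summed over \<open>k\<close>, the cross terms give \<open>tr (W A)\<close>: each covered
  \<open>u\<close> contributes \<open>entry u (partner u) * entry (partner u) u = 1\<close>.\<close>

lemma energy_deficit:
  "2 * (\<Sum>k<n. \<bar>l k\<bar>) - 2 * real (card (\<Union>M)) = (\<Sum>k<n. \<bar>l k\<bar> * deficit k)"
proof -
  have "(\<Sum>k<n. \<Sum>u\<in>\<Union>M. entry u (partner u) * (of_real (l k) * x k (partner u) * cnj (x k u)))
    = (\<Sum>u\<in>\<Union>M. entry u (partner u) * (\<Sum>k<n. of_real (l k) * x k (partner u) * cnj (x k u)))"
    by (subst sum.swap) (simp add: sum_distrib_left)
  also have "\<dots> = (\<Sum>u\<in>\<Union>M. 1)"
  proof (intro sum.cong refl)
    fix u assume u: "u \<in> \<Union>M"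
    have "partner u \<in> pverts G" "u \<in> pverts G"
      using u partner(3)[OF u] covered_subset by blast+
    then show "entry u (partner u) * (\<Sum>k<n. of_real (l k) * x k (partner u) * cnj (x k u)) = 1"
      using entry_mult_entry[OF partner(2)[OF u]] by (simp only: entry_expansion[symmetric])
  qed
  finally have "(\<Sum>k<n. Re (\<Sum>u\<in>\<Union>M. entry u (partner u) * (of_real (l k) * x k (partner u) * cnj (x k u))))
    = real (card (\<Union>M))"
    unfolding Re_sum[symmetric] by simp
  then show ?thesis
    by (simp add: abs_times_deficit sum_subtractf sum_distrib_left[symmetric])
qed

lemma energy_ge: "(\<Sum>k<n. \<bar>l k\<bar>) \<ge> real (card (\<Union>M))"
proof -
  have "(\<Sum>k<n. \<bar>l k\<bar> * deficit k) \<ge> 0"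
    by (intro sum_nonneg mult_nonneg_nonneg deficit_nonneg) auto
  then show ?thesis using energy_deficit by linarith
qed

lemma energy_eq_iff:
  "(\<Sum>k<n. \<bar>l k\<bar>) = real (card (\<Union>M)) \<longleftrightarrow> (\<forall>k<n. l k \<noteq> 0 \<longrightarrow> deficit k = 0)"
proof -
  have "(\<Sum>k<n. \<bar>l k\<bar>) = real (card (\<Union>M)) \<longleftrightarrow> (\<Sum>k<n. \<bar>l k\<bar> * deficit k) = 0"
    using energy_deficit by linarith
  also have "\<dots> \<longleftrightarrow> (\<forall>k<n. l k \<noteq> 0 \<longrightarrow> deficit k = 0)"
    by (subst sum_nonneg_eq_0_iff) (auto simp: deficit_nonneg)
  finally show ?thesis .
qed

end

section \<open>The equality case\<close>

text \<open>The right-hand side is nonzero, so the equation also asserts that \<open>a d\<close> is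
  an arc. Vertices may repeat; the case \<open>a = d\<close> excludes triangles.\<close>

definition (in unit_gain_graph) three_walk_closed :: bool where
  "three_walk_closed \<longleftrightarrow> (\<forall>a b c d. (a, b) \<in> parcs G \<longrightarrow> (b, c) \<in> parcs G \<longrightarrow> (c, d) \<in> parcs G \<longrightarrow>
     entry a d = entry a b * entry b c * entry c d)"

section \<open>From equality to closure of three-walks\<close>

context gain_eigenbasis_matching
begin

text \<open>At an uncovered vertex all eigenvectors with nonzero eigenvalue vanish, hence so does
  the whole row of \<open>A\<close>.\<close>

lemma arcs_covered_if_deficit_0:
  assumes def0: "\<forall>k<n. l k \<noteq> 0 \<longrightarrow> deficit k = 0"
  shows "fst ` parcs G \<subseteq> \<Union>M"
proof (rule ccontr)
  assume "\<not> fst ` parcs G \<subseteq> \<Union>M"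
  then obtain u v where uv: "(u, v) \<in> parcs G" and "u \<notin> \<Union>M"
    by (metis image_subsetI prod.collapse)
  then have "entry u v = 0"
    using def0 in_arcsD1[OF uv] in_arcsD2[OF uv]
    by (subst entry_expansion) (auto simp: deficit_eq_0_iff intro!: sum.neutral)
  then show False using uv by simp
qed

text \<open>The identity \<open>W A = \<bar>A\<bar>\<close> in entries: a zero deficit replaces
  \<open>W (x k)\<close> by \<open>sgn (l k) x k\<close>, and
  \<open>l k * sgn (l k) = \<bar>l k\<bar>\<close>.\<close>

lemma matched_entry_expansion:
  assumes def0: "\<forall>k<n. l k \<noteq> 0 \<longrightarrow> deficit k = 0"
    and u: "u \<in> \<Union>M" and v: "v \<in> pverts G"
  shows "entry u (partner u) * entry (partner u) v = (\<Sum>k<n. of_real \<bar>l k\<bar> * x k u * cnj (x k v))"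
proof -
  have "partner u \<in> pverts G" using u partner(3)[OF u] covered_subset by blast
  then have "entry u (partner u) * entry (partner u) v
    = (\<Sum>k<n. of_real (l k) * (entry u (partner u) * x k (partner u)) * cnj (x k v))"
    using v by (simp add: entry_expansion sum_distrib_left ac_simps)
  also have "\<dots> = (\<Sum>k<n. of_real \<bar>l k\<bar> * x k u * cnj (x k v))"
  proof (intro sum.cong refl)
    fix k assume "k \<in> {..<n}"
    then have "l k \<noteq> 0 \<Longrightarrow> entry u (partner u) * x k (partner u) = of_real (sgn (l k)) * x k u"
      using def0 u by (auto simp: deficit_eq_0_iff)
    then show "of_real (l k) * (entry u (partner u) * x k (partner u)) * cnj (x k v)
      = of_real \<bar>l k\<bar> * x k u * cnj (x k v)"
      by (cases "l k = 0") (auto simp: abs_sgn)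
  qed
  finally show ?thesis .
qed

text \<open>The matrix \<open>P = W A\<close> is a Gram matrix with unit diagonal on covered
  vertices. An entry of modulus 1 is the equality case of Cauchy-Schwarz and makes two rows of
  \<open>P\<close> proportional.\<close>

lemma entry_via_partner:
  assumes def0: "\<forall>k<n. l k \<noteq> 0 \<longrightarrow> deficit k = 0"
    and ab: "(a, b) \<in> parcs G" and w: "w \<in> pverts G"
  shows "entry a w = entry a b * (entry b (partner b) * entry (partner b) w)"
proof -
  note cov = arcs_covered_if_deficit_0[OF def0]
  have S: "a \<in> \<Union>M" "b \<in> \<Union>M" by (rule covered_arcsD[OF cov ab])+
  \<comment> \<open>Row \<open>a'\<close> of \<open>P\<close> is row \<open>a\<close> of
    \<open>A\<close> times \<open>entry a' a\<close>, so the arc \<open>a b\<close> yields an entry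
    \<open>P a' b\<close> of modulus 1.\<close>
  define a' where "a' = partner a"
  have a': "a' \<in> \<Union>M" "partner a' = a" using S(1) partner by (auto simp: a'_def)
  define P where "P = (\<lambda>u v. entry u (partner u) * entry (partner u) v)"
  have P: "P u v = (\<Sum>k<n. of_real \<bar>l k\<bar> * x k u * cnj (x k v))" if "u \<in> \<Union>M" "v \<in> pverts G" for u v
    unfolding P_def using that by (rule matched_entry_expansion[OF def0])
  have P1: "(\<Sum>k<n. \<bar>l k\<bar> * (cmod (x k u))\<^sup>2) = 1" if "u \<in> \<Union>M" for u
  proof -
    have "P u u = 1" unfolding P_def by (rule entry_mult_entry[OF partner(2)[OF that]])
    moreover have "P u u = of_real (\<Sum>k<n. \<bar>l k\<bar> * (cmod (x k u))\<^sup>2)"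
      using P[OF that] that covered_subset
      by (simp add: mult.assoc complex_norm_square[symmetric] subset_iff)
    ultimately show ?thesis by (metis of_real_eq_1_iff)
  qed
  define p where "p = P a' b"
  have p: "cmod p = 1"
    using ab partner(2)[OF S(1)] arcs_symmetric
    by (simp add: p_def P_def a'(2)) (simp add: a'_def norm_mult cmod_entry)
  \<comment> \<open>The weighted squared distance between the Gram vector of \<open>a'\<close> and
    \<open>p\<close> times that of \<open>b\<close> is \<open>1 + 1 - 2 = 0\<close>, so they agree
    wherever \<open>l k \<noteq> 0\<close>.\<close>
  have "(\<Sum>k<n. \<bar>l k\<bar> * (cmod (x k a' - p * x k b))\<^sup>2)
    = (\<Sum>k<n. \<bar>l k\<bar> * (cmod (x k a'))\<^sup>2) + (\<Sum>k<n. \<bar>l k\<bar> * (cmod (x k b))\<^sup>2)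
      - 2 * Re (cnj p * (\<Sum>k<n. of_real \<bar>l k\<bar> * x k a' * cnj (x k b)))"
    unfolding sum_distrib_left Re_sum sum.distrib[symmetric] sum_subtractf[symmetric]
    by (intro sum.cong refl)
      (simp add: cmod_diff_sq norm_mult p power_mult_distrib algebra_simps)
  also have "\<dots> = 2 - 2 * Re (cnj p * p)"
    using P1[OF a'(1)] P1[OF S(2)] P[OF a'(1), of b] S(2) covered_subset
    by (simp add: p_def subset_iff)
  also have "cnj p * p = 1"
    using p complex_norm_square[of p] by (simp add: mult.commute)
  finally have "(\<Sum>k<n. \<bar>l k\<bar> * (cmod (x k a' - p * x k b))\<^sup>2) = 0" by simp
  then have eq: "l k = 0 \<or> x k a' = p * x k b" if "k < n" for k
    using that by (subst (asm) sum_nonneg_eq_0_iff) auto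
  have "P a' w = (\<Sum>k<n. p * (of_real \<bar>l k\<bar> * x k b * cnj (x k w)))"
    unfolding P[OF a'(1) w]
  proof (intro sum.cong refl)
    fix k assume "k \<in> {..<n}"
    then show "of_real \<bar>l k\<bar> * x k a' * cnj (x k w) = p * (of_real \<bar>l k\<bar> * x k b * cnj (x k w))"
      using eq[of k] by auto
  qed
  also have "\<dots> = p * P b w"
    unfolding P[OF S(2) w] by (simp add: sum_distrib_left)
  finally have "entry a a' * P a' w = entry a a' * (p * P b w)" by simp
  moreover have "entry a a' * entry a' a = 1"
    unfolding a'_def by (rule entry_mult_entry[OF partner(2)[OF S(1)]])
  ultimately show ?thesis
    by (simp add: p_def P_def a'(2) mult.assoc[symmetric])
qed

text \<open>Both \<open>a\<close> and \<open>c\<close> are neighbours of \<open>b\<close>, so their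
  rows in \<open>A\<close> are multiples of row \<open>b\<close> of \<open>W A\<close>; compare them
  at \<open>d\<close>.\<close>

lemma three_walk_closed_if_deficit_0:
  assumes def0: "\<forall>k<n. l k \<noteq> 0 \<longrightarrow> deficit k = 0"
  shows three_walk_closed
  unfolding three_walk_closed_def
proof (intro allI impI)
  fix a b c d assume arcs: "(a, b) \<in> parcs G" "(b, c) \<in> parcs G" "(c, d) \<in> parcs G"
  define q where "q = entry b (partner b) * entry (partner b) d"
  have d: "d \<in> pverts G" using arcs(3) in_arcsD2 by blast
  have "entry a d = entry a b * q" "entry c d = entry c b * q"
    using entry_via_partner[OF def0 _ d] arcs(1) arcs_symmetric[OF arcs(2)] unfolding q_def by blast+
  moreover have "entry b c * entry c b = 1" by (rule entry_mult_entry[OF arcs(2)])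
  ultimately show "entry a d = entry a b * entry b c * entry c d"
    by (simp add: mult.assoc)
qed

end

section \<open>From closure of three-walks to equality\<close>

context unit_gain_graph
begin

definition nbrs :: "'v \<Rightarrow> 'v set" where "nbrs u = {v. (u, v) \<in> parcs G}"

lemma mem_nbrs [simp]: "v \<in> nbrs u \<longleftrightarrow> (u, v) \<in> parcs G"
  by (simp add: nbrs_def)

lemma finite_nbrs [simp]: "finite (nbrs u)"
  using finite_verts in_arcsD2 by (auto intro: finite_subset[of _ "pverts G"])

lemma three_walk_closedD:
  assumes three_walk_closed and "(a, b) \<in> parcs G" "(b, c) \<in> parcs G" "(c, d) \<in> parcs G"
  shows "entry a d = entry a b * entry b c * entry c d" and "(a, d) \<in> parcs G"
proof -
  show "entry a d = entry a b * entry b c * entry c d"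
    using assms unfolding three_walk_closed_def by blast
  then have "entry a d \<noteq> 0" using assms(2-4) by simp
  then show "(a, d) \<in> parcs G" by simp
qed

end

text \<open>\<open>partner\<close> exchanges the two neighbourhoods: for an arc \<open>c d\<close>
  and a neighbour \<open>b\<close> of \<open>c\<close>, the walk from \<open>partner b\<close>
  through \<open>b\<close> and \<open>c\<close> to \<open>d\<close> closes up.\<close>

lemma (in gain_matching) card_nbrs_eq:
  assumes three_walk_closed and cov: "fst ` parcs G \<subseteq> \<Union>M"
    and uv: "(u, v) \<in> parcs G"
  shows "card (nbrs u) = card (nbrs v)"
proof (rule bij_betw_same_card)
  have "partner b \<in> nbrs d" if "b \<in> nbrs c" "(c, d) \<in> parcs G" for b c d
  proof -
    have "b \<in> \<Union>M" using that(1) by (intro covered_arcsD(2)[OF cov, of c]) simp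
    then have "(partner b, b) \<in> parcs G" by (blast intro: partner arcs_symmetric)
    then have "(partner b, d) \<in> parcs G"
      using three_walk_closedD(2)[OF assms(1), of _ b c d] that arcs_symmetric[of c b] by simp
    then show ?thesis by (simp add: arcs_symmetric)
  qed
  moreover have "partner (partner b) = b" if "b \<in> nbrs c" for b c
  proof -
    have "b \<in> \<Union>M" using that by (intro covered_arcsD(2)[OF cov, of c]) simp
    then show ?thesis by (rule partner(4))
  qed
  ultimately show "bij_betw partner (nbrs u) (nbrs v)"
    using uv arcs_symmetric[OF uv] by (intro bij_betwI[of _ _ _ partner]) auto
qed

text \<open>On covered vertices \<open>A\<close> squared equals \<open>D W A\<close> with
  \<open>D\<close> the diagonal matrix of degrees. Hence \<open>l k * x k = D W (x k)\<close>, and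
  applying this at both ends of a matching edge forces \<open>\<bar>l k\<bar>\<close> to be the
  degree unless \<open>x k\<close> vanishes there.\<close>

lemma (in gain_eigenbasis_matching) deficit_0_if_three_walk_closed:
  assumes twc: three_walk_closed and cov: "fst ` parcs G \<subseteq> \<Union>M"
    and k: "k < n" "l k \<noteq> 0"
  shows "deficit k = 0"
proof -
  have x0: "x k u = 0" if "u \<in> pverts G - \<Union>M" for u
  proof -
    have "of_real (l k) * x k u = (\<Sum>v\<in>pverts G. 0)"
      unfolding eigen[OF k(1), of u, symmetric, OF DiffD1[OF that]]
      using that covered_arcsD(1)[OF cov] by (intro sum.cong refl) auto
    then show ?thesis using k(2) by simp
  qed
  have step: "of_real (l k) * x k u = of_nat (card (nbrs u)) * entry u (partner u) * x k (partner u)"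
    if u: "u \<in> \<Union>M" for u
  proof -
    let ?u = "partner u"
    have uV: "u \<in> pverts G" and u'V: "?u \<in> pverts G" using u partner(3)[OF u] covered_subset by auto
    \<comment> \<open>All two-step walks from \<open>u\<close> to \<open>w\<close> have the gain of
      the one through the partner, and a missing arc on one side is missing on the other.\<close>
    have via: "entry u b * entry b w = entry u ?u * entry ?u w" if "(u, b) \<in> parcs G" for b w
    proof (cases "(b, w) \<in> parcs G")
      case True
      have "entry ?u w = entry ?u u * entry u b * entry b w"
        by (rule three_walk_closedD(1)[OF twc arcs_symmetric[OF partner(2)[OF u]] that True])
      then show ?thesis using entry_mult_entry[OF partner(2)[OF u]]
        by (simp add: mult.assoc)
    next
      case False
      then have "(?u, w) \<notin> parcs G"
        using three_walk_closedD(2)[OF twc arcs_symmetric[OF that] partner(2)[OF u]] by blast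
      then show ?thesis using False by (simp add: entry_def)
    qed
    have "of_real (l k) * (of_real (l k) * x k u)
      = (\<Sum>b\<in>pverts G. entry u b * (of_real (l k) * x k b))"
      by (simp add: eigen[OF k(1) uV, symmetric] sum_distrib_left ac_simps)
    also have "\<dots> = (\<Sum>b\<in>nbrs u. entry u b * (of_real (l k) * x k b))"
      using finite_verts in_arcsD2 by (intro sum.mono_neutral_right) auto
    also have "\<dots> = (\<Sum>b\<in>nbrs u. \<Sum>w\<in>pverts G. entry u b * entry b w * x k w)"
      using in_arcsD2 by (intro sum.cong refl) (auto simp: eigen[OF k(1), symmetric] sum_distrib_left ac_simps)
    also have "\<dots> = (\<Sum>b\<in>nbrs u. entry u ?u * (\<Sum>w\<in>pverts G. entry ?u w * x k w))"
    proof (intro sum.cong refl)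
      fix b assume "b \<in> nbrs u"
      then have "entry u b * entry b w = entry u ?u * entry ?u w" for w by (intro via) simp
      then show "(\<Sum>w\<in>pverts G. entry u b * entry b w * x k w)
        = entry u ?u * (\<Sum>w\<in>pverts G. entry ?u w * x k w)"
        by (simp only: sum_distrib_left mult.assoc[symmetric])
    qed
    also have "\<dots> = of_real (l k) * (of_nat (card (nbrs u)) * entry u ?u * x k ?u)"
      unfolding eigen[OF k(1) u'V] by (simp add: ac_simps)
    finally show ?thesis using k(2) by simp
  qed
  have "entry u (partner u) * x k (partner u) = of_real (sgn (l k)) * x k u" if u: "u \<in> \<Union>M" for u
  proof -
    define d where "d = card (nbrs u)"
    have "partner u \<in> nbrs u" using partner(2)[OF u] by simp
    then have d: "d > 0" unfolding d_def card_gt_0_iff by auto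
    \<comment> \<open>Equal degrees at \<open>u\<close> and its partner let \<open>step\<close> be
      used both ways, as \<open>l k * x k u = d * y\<close> and
      \<open>l k * y = d * x k u\<close>.\<close>
    have d': "card (nbrs (partner u)) = d"
      unfolding d_def by (rule card_nbrs_eq[OF twc cov partner(2)[OF u], symmetric])
    define y where "y = entry u (partner u) * x k (partner u)"
    have 1: "of_real (l k) * x k u = of_nat d * y"
      using step[OF u] by (simp add: d_def y_def)
    have "of_real (l k) * x k (partner u) = of_nat d * entry (partner u) u * x k u"
      using step[OF partner(3)[OF u]] by (simp add: d' partner(4)[OF u])
    then have "of_real (l k) * y = of_nat d * (entry u (partner u) * entry (partner u) u) * x k u"
      by (simp add: y_def mult.left_commute mult.assoc)
    then have 2: "of_real (l k) * y = of_nat d * x k u"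
      by (simp add: entry_mult_entry[OF partner(2)[OF u]])
    have "of_real ((l k)\<^sup>2) * y = of_real (l k) * (of_nat d * x k u)"
      using 2 by (simp add: power2_eq_square)
    also have "\<dots> = of_nat d * (of_real (l k) * x k u)" by (simp add: ac_simps)
    also have "\<dots> = of_real ((real d)\<^sup>2) * y" unfolding 1 by (simp add: power2_eq_square)
    finally have "y = 0 \<or> (l k)\<^sup>2 = (real d)\<^sup>2"
      by (metis mult_cancel_right of_real_eq_iff)
    then show ?thesis
    proof
      assume "y = 0"
      then have "x k u = 0" using 2 d by simp
      then show ?thesis using \<open>y = 0\<close> by (simp add: y_def)
    next
      assume "(l k)\<^sup>2 = (real d)\<^sup>2"
      then have "\<bar>l k\<bar> = real d" by (metis abs_of_nat power2_eq_iff abs_eq_iff)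
      then have "l k = sgn (l k) * real d" by (metis abs_sgn mult.commute sgn_mult_abs)
      then have "sgn (l k) * l k = real d" by (metis \<open>\<bar>l k\<bar> = real d\<close> mult.commute abs_sgn)
      have "of_nat d * (of_real (sgn (l k)) * x k u) = of_real (sgn (l k)) * (of_real (l k) * y)"
        unfolding 2 by (simp add: ac_simps)
      also have "\<dots> = of_real (sgn (l k) * l k) * y" by simp
      also have "\<dots> = of_nat d * y" unfolding \<open>sgn (l k) * l k = real d\<close> by simp
      finally show ?thesis using d by (simp add: y_def)
    qed
  qed
  then show ?thesis using x0 by (simp add: deficit_eq_0_iff)
qed

lemma (in gain_eigenbasis_matching) energy_eq_iff_three_walk_closed:
  "(\<Sum>k<n. \<bar>l k\<bar>) = real (card (\<Union>M)) \<longleftrightarrow>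
    three_walk_closed \<and> fst ` parcs G \<subseteq> \<Union>M"
proof -
  have "(\<forall>k<n. l k \<noteq> 0 \<longrightarrow> deficit k = 0) \<longleftrightarrow> three_walk_closed \<and> fst ` parcs G \<subseteq> \<Union>M"
  proof
    assume "\<forall>k<n. l k \<noteq> 0 \<longrightarrow> deficit k = 0"
    then show "three_walk_closed \<and> fst ` parcs G \<subseteq> \<Union>M"
      by (intro conjI three_walk_closed_if_deficit_0 arcs_covered_if_deficit_0)
  qed (simp add: deficit_0_if_three_walk_closed)
  then show ?thesis unfolding energy_eq_iff .
qed

section \<open>Balanced unions of regular complete bipartite graphs\<close>

context unit_gain_graph
begin

text \<open>Peel off two arcs: by induction the rest of the walk has the gain of a single arc, and
  the resulting three-walk closes up.\<close>

lemma walk_gain_odd: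
  assumes twc: three_walk_closed
  shows "\<lbrakk>awalk u p v; odd (length p)\<rbrakk> \<Longrightarrow> entry u v = walk_gain \<phi> p \<and> (u, v) \<in> parcs G"
proof (induction p arbitrary: u rule: induct_list012)
  case (2 e)
  then show ?case by (cases e) (auto simp: awalk_simps walk_gain_def entry_def)
next
  case (3 e1 e2 p)
  obtain a b c where e: "e1 = (u, b)" "e2 = (b, c)" "(u, b) \<in> parcs G" "(b, c) \<in> parcs G"
    "awalk c p v"
    using 3(3) by (cases e1, cases e2) (auto simp: awalk_Cons_iff)
  then have "entry c v = walk_gain \<phi> p" "(c, v) \<in> parcs G"
    using 3(1)[OF e(5)] 3(4) by auto
  then show ?case
    using three_walk_closedD[OF twc e(3,4)] e by (auto simp: walk_gain_def entry_def)
qed simp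

text \<open>A closed walk of odd length would yield a loop. In an even one, all arcs but the first
  form an odd walk, whose gain is that of the reversed first arc.\<close>

lemma balanced_if_three_walk_closed:
  assumes twc: three_walk_closed
  shows "balanced G \<phi>"
  unfolding balanced_def graph_cycle_def
proof (intro allI impI, elim conjE)
  fix p assume "cycle p"
  then obtain u where p: "awalk u p u" "p \<noteq> []" by (auto simp: cycle_def)
  have "even (length p)"
    using walk_gain_odd[OF twc p(1)] no_loops' by blast
  then obtain w q where q: "p = (u, w) # q" "(u, w) \<in> parcs G" "awalk w q u" "odd (length q)"
    using p by (cases p) (auto simp: awalk_Cons_iff)
  then have "walk_gain \<phi> p = entry u w * entry w u"
    using walk_gain_odd[OF twc q(3,4)] by (simp add: walk_gain_def entry_def[of u w])
  then show "walk_gain \<phi> p = 1" by (simp add: entry_mult_entry q(2))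
qed

text \<open>The sides are the first and second neighbourhoods of \<open>w\<close>, so no neighbour
  has to be chosen. For a neighbour \<open>v\<close>, closure makes the second side
  \<open>nbrs v\<close>.\<close>

definition component :: "'v \<Rightarrow> 'v pair_pre_digraph" where
  "component w = \<lparr>pverts = nbrs w \<union> (\<Union>z\<in>nbrs w. nbrs z),
     parcs = nbrs w \<times> (\<Union>z\<in>nbrs w. nbrs z) \<union> (\<Union>z\<in>nbrs w. nbrs z) \<times> nbrs w\<rparr>"

context
  assumes twc: three_walk_closed
begin

text \<open>For \<open>z\<close> adjacent to \<open>v\<close>, the walk \<open>w u v z\<close>
  closes up to an arc \<open>w z\<close>.\<close>

lemma nbrs_nbr:
  assumes "(u, v) \<in> parcs G" and "(u, w) \<in> parcs G"
  shows "nbrs v = nbrs w"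
proof -
  have "nbrs v \<subseteq> nbrs w" if "(u, v) \<in> parcs G" "(u, w) \<in> parcs G" for v w
    using three_walk_closedD(2)[OF twc arcs_symmetric[OF that(2)] that(1)] by auto
  then show ?thesis using assms by blast
qed

lemma component_eq:
  assumes "(w, v) \<in> parcs G"
  shows "component w = \<lparr>pverts = nbrs w \<union> nbrs v, parcs = nbrs w \<times> nbrs v \<union> nbrs v \<times> nbrs w\<rparr>"
proof -
  have "nbrs z = nbrs v" if "z \<in> nbrs w" for z
    using nbrs_nbr[of w z v] assms that by simp
  then have "(\<Union>z\<in>nbrs w. nbrs z) = (\<Union>z\<in>nbrs w. nbrs v)"
    by (rule SUP_cong[OF refl])
  also have "\<dots> = nbrs v" using assms by auto
  finally have "(\<Union>z\<in>nbrs w. nbrs z) = nbrs v" .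
  then show ?thesis by (simp add: component_def)
qed

text \<open>Any vertex of a component determines it, which makes distinct components
  disjoint.\<close>

lemma component_cong:
  assumes "(w, v) \<in> parcs G" and "z \<in> pverts (component w)"
  shows "component z = component w"
proof -
  note wv = assms(1) and vw = arcs_symmetric[OF assms(1)]
  have "z \<in> nbrs w \<or> z \<in> nbrs v" using assms by (simp add: component_eq)
  then show ?thesis
  proof
    assume "z \<in> nbrs w"
    then have "nbrs z = nbrs v" "(z, w) \<in> parcs G"
      using nbrs_nbr[OF wv] arcs_symmetric by auto
    then show ?thesis by (simp add: component_eq[OF wv] component_eq[of z w] Un_commute)
  next
    assume "z \<in> nbrs v"
    then have "nbrs z = nbrs w" "(z, v) \<in> parcs G"
      using nbrs_nbr[OF vw] arcs_symmetric by auto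
    then show ?thesis by (simp add: component_eq[OF wv] component_eq[of z v])
  qed
qed

text \<open>A common neighbour \<open>w\<close> would close the walk \<open>u v w u\<close> up to a
  loop.\<close>

lemma nbrs_disjoint:
  assumes "(u, v) \<in> parcs G"
  shows "nbrs u \<inter> nbrs v = {}"
proof (rule ccontr)
  assume "nbrs u \<inter> nbrs v \<noteq> {}"
  then obtain w where "(u, w) \<in> parcs G" "(v, w) \<in> parcs G" by auto
  then have "(u, u) \<in> parcs G"
    using three_walk_closedD(2)[OF twc assms] arcs_symmetric by blast
  then show False using no_loops' by blast
qed

end

end

text \<open>For an arc \<open>w v\<close> the sides of the component are \<open>nbrs w\<close> and
  \<open>nbrs v\<close>; the covering matching enters through \<open>card_nbrs_eq\<close>, which
  gives them equal size.\<close>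

lemma (in gain_matching) union_if_three_walk_closed:
  assumes twc: three_walk_closed and cov: "fst ` parcs G \<subseteq> \<Union>M"
  shows "union_of_regular_complete_bipartite G"
  unfolding union_of_regular_complete_bipartite_def
proof (intro exI conjI)
  let ?H = "component ` {w. \<exists>v. (w, v) \<in> parcs G}"
  let ?I = "{w \<in> pverts G. \<forall>v. (w, v) \<notin> parcs G}"
  note eq = component_eq[OF twc]
  show "\<forall>H\<in>?H. \<exists>m\<ge>1. complete_bipartite_digraph m m (with_proj H)"
  proof
    fix H assume "H \<in> ?H"
    then obtain w v where wv: "(w, v) \<in> parcs G" and H: "H = component w" by blast
    have "card (nbrs w) \<ge> 1"
      using wv by (auto simp: Suc_le_eq card_gt_0_iff)
    moreover have "complete_bipartite_digraph (card (nbrs w)) (card (nbrs w)) (with_proj H)"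
      unfolding complete_bipartite_digraph_pair_def H eq[OF wv]
      using nbrs_disjoint[OF twc wv] card_nbrs_eq[OF twc cov wv]
      by (intro conjI exI[of _ "nbrs w"] exI[of _ "nbrs v"]) auto
    ultimately show "\<exists>m\<ge>1. complete_bipartite_digraph m m (with_proj H)" by blast
  qed
  show "pairwise (\<lambda>H H'. disjnt (pverts H) (pverts H')) ?H"
  proof (rule pairwiseI)
    fix H H' assume H: "H \<in> ?H" "H' \<in> ?H" "H \<noteq> H'"
    then obtain w v w' v' where "(w, v) \<in> parcs G" "H = component w"
      "(w', v') \<in> parcs G" "H' = component w'" by blast
    then have "\<And>z. z \<in> pverts H \<Longrightarrow> component z = H" "\<And>z. z \<in> pverts H' \<Longrightarrow> component z = H'"
      using component_cong[OF twc] by blast+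
    then show "disjnt (pverts H) (pverts H')" using H(3) unfolding disjnt_iff by metis
  qed
  have noniso: "\<exists>v. (z, v) \<in> parcs G" if "(w, v) \<in> parcs G" "z \<in> pverts (component w)" for w v z
    using that arcs_symmetric by (auto simp: eq[OF that(1)])
  show "\<forall>H\<in>?H. disjnt (pverts H) ?I"
    using noniso by (fastforce simp: disjnt_iff)
  have in_comp: "w \<in> pverts (component w)" if "(w, v) \<in> parcs G" for w v
    using arcs_symmetric[OF that] by (simp add: eq[OF that])
  show "pverts G = (\<Union>H\<in>?H. pverts H) \<union> ?I"
  proof (intro equalityI subsetI)
    fix z assume "z \<in> pverts G"
    then show "z \<in> (\<Union>H\<in>?H. pverts H) \<union> ?I" using in_comp by blast
  next
    fix z assume "z \<in> (\<Union>H\<in>?H. pverts H) \<union> ?I"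
    then show "z \<in> pverts G" using noniso in_arcsD1 by blast
  qed
  show "parcs G = (\<Union>H\<in>?H. parcs H)"
  proof (intro equalityI subsetI)
    fix e assume "e \<in> parcs G"
    then obtain u v where e: "e = (u, v)" "(u, v) \<in> parcs G" by (cases e) auto
    then have "e \<in> parcs (component u)" using arcs_symmetric by (simp add: eq[OF e(2)])
    then show "e \<in> (\<Union>H\<in>?H. parcs H)" using e(2) by blast
  next
    fix e assume "e \<in> (\<Union>H\<in>?H. parcs H)"
    then obtain w v where wv: "(w, v) \<in> parcs G" and e: "e \<in> parcs (component w)" by auto
    obtain a b where ab: "e = (a, b)" by (cases e)
    \<comment> \<open>The walk \<open>p w v q\<close> closes up, so the two sides are completely
      joined.\<close>
    have arc: "(p, q) \<in> parcs G" if "(w, p) \<in> parcs G" "(v, q) \<in> parcs G" for p q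
      using three_walk_closedD(2)[OF twc arcs_symmetric[OF that(1)] wv that(2)] .
    have "(w, a) \<in> parcs G \<and> (v, b) \<in> parcs G \<or> (v, a) \<in> parcs G \<and> (w, b) \<in> parcs G"
      using e by (simp add: ab eq[OF wv])
    then show "e \<in> parcs G"
      unfolding ab using arc[of a b] arc[of b a] arcs_symmetric[of b a] by blast
  qed
qed

section \<open>From balanced unions back to closure and covering\<close>

context unit_gain_graph
begin

lemma obtain_complete_bipartite_component:
  assumes "union_of_regular_complete_bipartite G" and "(u, v) \<in> parcs G"
  obtains U V where "u \<in> U" "v \<in> V" "U \<inter> V = {}" "card U = card V" "finite U" "finite V"
    "\<And>a b. a \<in> U \<Longrightarrow> (a, b) \<in> parcs G \<longleftrightarrow> b \<in> V"
    "\<And>a b. b \<in> V \<Longrightarrow> (b, a) \<in> parcs G \<longleftrightarrow> a \<in> U"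
proof -
  obtain \<H> and I :: "'v set" where
    H: "\<forall>H\<in>\<H>. \<exists>m\<ge>1. complete_bipartite_digraph m m (with_proj H)"
    and disj: "pairwise (\<lambda>H H'. disjnt (pverts H) (pverts H')) \<H>"
    and arcs: "parcs G = (\<Union>H\<in>\<H>. parcs H)"
    using assms(1) unfolding union_of_regular_complete_bipartite_def
    by (elim exE conjE) (rule that)
  obtain H where uv: "H \<in> \<H>" "(u, v) \<in> parcs H" using assms(2) arcs by auto
  obtain m where "complete_bipartite_digraph m m (with_proj H)" using H uv(1) by blast
  then obtain U V where UV: "pverts H = U \<union> V" "U \<inter> V = {}" "card U = m" "card V = m"
    "parcs H = U \<times> V \<union> V \<times> U" "finite (pverts H)"
    unfolding complete_bipartite_digraph_pair_def by (elim exE conjE) (rule that)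
  \<comment> \<open>An arc starting in \<open>H\<close> lies in some member of the family that
    shares a vertex with \<open>H\<close>, and disjointness identifies the two.\<close>
  have local_arcs: "(a, b) \<in> parcs G \<longleftrightarrow> (a, b) \<in> parcs H" if a: "a \<in> pverts H" for a b
  proof
    assume "(a, b) \<in> parcs G"
    then obtain H' where H': "H' \<in> \<H>" "(a, b) \<in> parcs H'" using arcs by auto
    moreover obtain m' where "complete_bipartite_digraph m' m' (with_proj H')"
      using H H'(1) by blast
    ultimately have "a \<in> pverts H'"
      unfolding complete_bipartite_digraph_pair_def by auto
    then have "\<not> disjnt (pverts H') (pverts H)" using a by (auto simp: disjnt_iff)
    then have "H' = H" using pairwiseD[OF disj H'(1) uv(1)] by blast
    then show "(a, b) \<in> parcs H" using H' by simp
  qed (use arcs uv(1) in blast)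
  have 1: "(a, b) \<in> parcs G \<longleftrightarrow> b \<in> V" if "a \<in> U" for a b
    using that UV local_arcs[of a b] by auto
  have 2: "(b, a) \<in> parcs G \<longleftrightarrow> a \<in> U" if "b \<in> V" for a b
    using that UV local_arcs[of b a] by auto
  have fin: "finite U" "finite V" using UV(1,6) by auto
  have "u \<in> U \<and> v \<in> V \<or> u \<in> V \<and> v \<in> U" using uv(2) UV(5) by auto
  then show thesis
    using that[of U V] that[of V U] UV(2-4) 1 2 fin by (auto simp: Int_commute)
qed

text \<open>A three-walk alternates between the sides, so its ends are adjacent. It either
  backtracks, and two gains cancel, or completes to a neutral 4-cycle.\<close>

lemma three_walk_closed_if_balanced:
  assumes bal: "balanced G \<phi>" and union: "union_of_regular_complete_bipartite G"
  shows three_walk_closed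
  unfolding three_walk_closed_def
proof (intro allI impI)
  fix a b c d assume arcs: "(a, b) \<in> parcs G" "(b, c) \<in> parcs G" "(c, d) \<in> parcs G"
  obtain U V where UV: "a \<in> U" "b \<in> V" "U \<inter> V = {}" "card U = card V" "finite U" "finite V"
    "\<And>a b. a \<in> U \<Longrightarrow> (a, b) \<in> parcs G \<longleftrightarrow> b \<in> V"
    "\<And>a b. b \<in> V \<Longrightarrow> (b, a) \<in> parcs G \<longleftrightarrow> a \<in> U"
    by (rule obtain_complete_bipartite_component[OF union arcs(1)]) (rule that)
  then have mem: "c \<in> U" "d \<in> V" using arcs by simp_all
  then have ad: "(a, d) \<in> parcs G" using UV by simp
  consider "a = c" | "b = d" | "a \<noteq> c" "b \<noteq> d" by blast
  then show "entry a d = entry a b * entry b c * entry c d"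
  proof cases
    case 1
    then show ?thesis using entry_mult_entry[OF arcs(1)] by simp
  next
    case 2
    then show ?thesis using entry_mult_entry[OF arcs(2)] by (simp add: mult.assoc)
  next
    case 3
    let ?p = "[(a, b), (b, c), (c, d), (d, a)]"
    have "awalk a ?p a"
      using arcs arcs_symmetric[OF ad] in_arcsD1 by (auto simp: awalk_simps)
    moreover have "distinct (tl (awalk_verts a ?p))"
      using 3 mem UV(1-3) by auto
    ultimately have "graph_cycle G ?p"
      unfolding graph_cycle_def cycle_def by auto
    then have "entry a b * entry b c * entry c d * entry d a = 1"
      using bal arcs arcs_symmetric[OF ad] unfolding balanced_def
      by (auto simp: walk_gain_def entry_def mult.assoc)
    moreover have "entry d a * entry a d = 1"
      by (rule entry_mult_entry[OF arcs_symmetric[OF ad]])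
    ultimately show ?thesis by (metis mult.assoc mult.right_neutral mult.left_neutral)
  qed
qed

end

text \<open>Augmentation: if \<open>u\<close> is uncovered, \<open>partner\<close> cannot inject the
  opposite side into \<open>U - {u}\<close>, which is too small. So some \<open>w\<close> there is
  uncovered, and \<open>{u, w}\<close> enlarges \<open>M\<close>.\<close>

lemma (in gain_matching) arcs_covered_if_union:
  assumes maximum: "\<And>M'. matching G M' \<Longrightarrow> card M' \<le> card M"
    and union: "union_of_regular_complete_bipartite G"
  shows "fst ` parcs G \<subseteq> \<Union>M"
proof (rule ccontr)
  assume "\<not> fst ` parcs G \<subseteq> \<Union>M"
  then obtain u v where uv: "(u, v) \<in> parcs G" and u: "u \<notin> \<Union>M"
    by (metis image_subsetI prod.collapse)
  obtain U V where UV: "u \<in> U" "v \<in> V" "U \<inter> V = {}" "card U = card V" "finite U" "finite V"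
    "\<And>a b. a \<in> U \<Longrightarrow> (a, b) \<in> parcs G \<longleftrightarrow> b \<in> V"
    "\<And>a b. b \<in> V \<Longrightarrow> (b, a) \<in> parcs G \<longleftrightarrow> a \<in> U"
    by (rule obtain_complete_bipartite_component[OF union uv]) (rule that)
  have "\<not> V \<subseteq> \<Union>M"
  proof
    assume V: "V \<subseteq> \<Union>M"
    have "partner w \<in> U - {u}" if "w \<in> V" for w
    proof -
      have "w \<in> \<Union>M" using that V by blast
      then have "(w, partner w) \<in> parcs G" "partner w \<in> \<Union>M" by (rule partner)+
      then show ?thesis using UV(8)[OF that, of "partner w"] u by auto
    qed
    moreover have "inj_on partner V"
      using bij_betw_partner V by (meson bij_betw_def inj_on_subset)
    ultimately have "card V \<le> card (U - {u})"
      using UV(5) by (intro card_inj_on_le[of partner]) auto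
    also have "\<dots> < card U" using UV(5,1) by (rule card_Diff1_less)
    finally show False using UV(4) by simp
  qed
  then obtain w where w: "w \<in> V" "w \<notin> \<Union>M" by blast
  then have uw: "(u, w) \<in> parcs G" using UV(1,7) by simp
  have "matching G (insert {u, w} M)"
    using matching uw u w(2)
    by (auto simp: matching_def edge_set_def pairwise_insert disjnt_iff)
  moreover have "finite M" using finite_covered finite_UnionD by blast
  moreover have "{u, w} \<notin> M" using u by blast
  ultimately have "matching G (insert {u, w} M)" "card (insert {u, w} M) = Suc (card M)" by auto
  then show False using maximum[of "insert {u, w} M"] by simp
qed

lemma (in unit_gain_graph) obtain_maximum_matching:
  obtains M where "matching G M" and "card M = matching_number G"
    and "\<And>M'. matching G M' \<Longrightarrow> card M' \<le> card M"
proof -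
  let ?C = "card ` {M. matching G M}"
  have "edge_set G \<subseteq> (\<lambda>(u, v). {u, v}) ` parcs G" by (auto simp: edge_set_def)
  then have "finite (edge_set G)" using finite_arcs finite_surj by blast
  then have "finite (Pow (edge_set G))" by simp
  then have fin: "finite ?C"
    by (intro finite_imageI) (auto simp: matching_def elim: rev_finite_subset)
  have "matching G {}" by (simp add: matching_def)
  then have "matching_number G \<in> ?C"
    unfolding matching_number_def using fin by (intro Max_in) auto
  then obtain M where M: "matching G M" "card M = matching_number G" by auto
  then show thesis
    using that[OF M] fin unfolding matching_number_def by auto
qed

theorem theorem1p1:
  fixes G :: "'v pair_pre_digraph"
    and \<phi> :: "'v \<times> 'v \<Rightarrow> complex"
    and vs :: "'v list"
  assumes "unit_gain_graph G \<phi>"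
    and "distinct vs" and "set vs = pverts G"
  shows "energy G \<phi> vs \<ge> 2 * real (matching_number G) \<and>
    (energy G \<phi> vs = 2 * real (matching_number G) \<longleftrightarrow>
       balanced G \<phi> \<and> union_of_regular_complete_bipartite G)"
proof -
  interpret unit_gain_graph G \<phi> by fact
  obtain l x where basis: "gain_eigenbasis G \<phi> (length vs) l x"
    and energy: "energy G \<phi> vs = (\<Sum>k<length vs. \<bar>l k\<bar>)"
    using obtain_gain_eigenbasis[OF assms(2,3)] by blast
  obtain M where M: "matching G M" "card M = matching_number G"
    "\<And>M'. matching G M' \<Longrightarrow> card M' \<le> card M"
    using obtain_maximum_matching by blast
  interpret gain_eigenbasis G \<phi> "length vs" l x by fact
  interpret gain_eigenbasis_matching G \<phi> "length vs" l x M
    by unfold_locales (rule M(1))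
  have card: "real (card (\<Union>M)) = 2 * real (matching_number G)"
    by (simp add: card_covered M(2))
  have "energy G \<phi> vs = 2 * real (matching_number G) \<longleftrightarrow>
      three_walk_closed \<and> fst ` parcs G \<subseteq> \<Union>M"
    unfolding energy card[symmetric] by (rule energy_eq_iff_three_walk_closed)
  \<comment> \<open>Left to right, covering serves to equalize the sides; right to left, it follows
    from maximality of \<open>M\<close>.\<close>
  also have "\<dots> \<longleftrightarrow> balanced G \<phi> \<and> union_of_regular_complete_bipartite G"
    using balanced_if_three_walk_closed union_if_three_walk_closed
      three_walk_closed_if_balanced arcs_covered_if_union[OF M(3)] by blast
  finally show ?thesis using energy_ge unfolding energy card by blast
qed

end
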